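(* Let $0<q<p<1$ (constants independent of $n$) with $p-q>\frac12$. Then the LP relaxation recovers the planted bisection in $G\sim\mathcal G_{n,p,q}$ with high probability.
   Context: $\mathcal G_{n,p,q}$ (stochastic block model), for $n$ even: a bisection $V_1,V_2$ (partition into two sets of size $n/2$) of $V=\{1,\dots,n\}$ is chosen uniformly at random, called the planted bisection; then, independently, each pair of nodes in the same part is joined by an edge with probability $p$, and each pair of nodes in different parts is joined by an edge with probability $q$. "With high probability" means with probability tending to $1$ as $n\to\infty$ (along even $n$). The LP relaxation (metric relaxation of the minimum bisection problem) associated with a graph $G=(V,E)$ is the following linear program in $x\in\mathbb R^{\binom n2}$, with coordinates $x_{ij}$, $1\le i<j\le n$, and the convention $x_{ji}:=x_{ij}$: $$\min\ \sum_{1\le i<j\le n}a_{ij}x_{ij}$$ subject to $x_{ij}\le x_{ik}+x_{jk}$ for all distinct $i,j,k\in\{1,\dots,n\}$ with $i<j$; $x_{ij}+x_{ik}+x_{jk}\le 2$ for all $1\le i<j<k\le n$; and $\sum_{1\le i<j\le n}x_{ij}=n^2/4$. Here $a_{ij}=1$ if $\{i,j\}\in E$ and $a_{ij}=0$ otherwise. The cut vector corresponding to the planted bisection is $\bar x\in\{0,1\}^{\binom n2}$ with $\bar x_{ij}=0$ if $i,j$ are in the same set of the bisection and $\bar x_{ij}=1$ otherwise. The LP relaxation recovers the planted bisection if $\bar x$ is its unique optimal solution. *)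

theory Defs
  imports "HOL-Probability.Probability" "HOL-Probability.Product_PMF" "HOL-Library.Disjoint_Sets"
begin

text \<open>A vector of \<open>\<real>\<close> to the power \<open>n choose 2\<close> is a function on the 2-element subsets of
  \<open>{1..n}\<close>, with \<open>x {i, j}\<close> for the coordinate of \<open>i, j\<close>; this builds in the convention that
  the \<open>j, i\<close> coordinate equals the \<open>i, j\<close> coordinate. Functions are taken to be extensional, so
  that equality of functions is equality of vectors.\<close>

definition node_pairs :: "nat \<Rightarrow> nat set set" where
  "node_pairs n = {e. e \<subseteq> {1..n} \<and> card e = 2}"

definition bisections :: "nat \<Rightarrow> nat set set set" where
  "bisections n = {P. partition_on {1..n} P \<and> card P = 2 \<and> (\<forall>A\<in>P. 2 * card A = n)}"

definition same_part :: "nat set set \<Rightarrow> nat set \<Rightarrow> bool" where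
  "same_part P e \<longleftrightarrow> (\<exists>A\<in>P. e \<subseteq> A)"

text \<open>The stochastic block model, as the joint distribution of the planted bisection and the edge
  set. It is meaningful only for even \<open>n \<ge> 2\<close>, since \<open>bisections n\<close> is empty otherwise.\<close>

definition sbm :: "nat \<Rightarrow> real \<Rightarrow> real \<Rightarrow> (nat set set \<times> nat set set) pmf" where
  "sbm n p q =
     bind_pmf (pmf_of_set (bisections n)) (\<lambda>P.
       map_pmf (\<lambda>f. (P, {e \<in> node_pairs n. f e}))
         (Pi_pmf (node_pairs n) False (\<lambda>e. bernoulli_pmf (if same_part P e then p else q))))"

definition lp_feasible :: "nat \<Rightarrow> (nat set \<Rightarrow> real) set" where
  "lp_feasible n = {x \<in> extensional (node_pairs n).
     (\<forall>i\<in>{1..n}. \<forall>j\<in>{1..n}. \<forall>k\<in>{1..n}.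
        i < j \<and> k \<noteq> i \<and> k \<noteq> j \<longrightarrow> x {i, j} \<le> x {i, k} + x {j, k}) \<and>
     (\<forall>i\<in>{1..n}. \<forall>j\<in>{1..n}. \<forall>k\<in>{1..n}.
        i < j \<and> j < k \<longrightarrow> x {i, j} + x {i, k} + x {j, k} \<le> 2) \<and>
     (\<Sum>e\<in>node_pairs n. x e) = real n ^ 2 / 4}"

definition lp_objective :: "nat \<Rightarrow> nat set set \<Rightarrow> (nat set \<Rightarrow> real) \<Rightarrow> real" where
  "lp_objective n E x = (\<Sum>e\<in>node_pairs n. (if e \<in> E then 1 else 0) * x e)"

definition lp_optimal :: "nat \<Rightarrow> nat set set \<Rightarrow> (nat set \<Rightarrow> real) \<Rightarrow> bool" where
  "lp_optimal n E x \<longleftrightarrow>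
     x \<in> lp_feasible n \<and> (\<forall>y\<in>lp_feasible n. lp_objective n E x \<le> lp_objective n E y)"

definition cut_vector :: "nat \<Rightarrow> nat set set \<Rightarrow> nat set \<Rightarrow> real" where
  "cut_vector n P = restrict (\<lambda>e. if same_part P e then 0 else 1) (node_pairs n)"

definition lp_recovers :: "nat \<Rightarrow> nat set set \<Rightarrow> nat set set \<Rightarrow> bool" where
  "lp_recovers n P E \<longleftrightarrow>
     lp_optimal n E (cut_vector n P) \<and> (\<forall>x. lp_optimal n E x \<longrightarrow> x = cut_vector n P)"

lemma finite_bisections: "finite (bisections n)"
  by (rule finite_subset[of _ "Pow (Pow {1..n})"]) (auto simp: bisections_def partition_on_def)

lemma bisections_nonempty:
  assumes "m \<ge> 1"
  shows "bisections (2 * m) \<noteq> {}"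
proof -
  let ?A = "{1..m}" and ?B = "{m + 1..2 * m}"
  have AB: "?A \<inter> ?B = {}" "?A \<union> ?B = {1..2 * m}" "?A \<noteq> {}" "?B \<noteq> {}"
    using assms by auto
  have ne: "?A \<noteq> ?B"
    using AB by blast
  have "partition_on {1..2 * m} {?A, ?B}"
    unfolding partition_on_def disjoint_def using AB by blast
  moreover have "card {?A, ?B} = 2"
    unfolding card_2_iff using ne by blast
  moreover have "\<forall>A\<in>{?A, ?B}. 2 * card A = 2 * m"
    by simp
  ultimately have "{?A, ?B} \<in> bisections (2 * m)"
    unfolding bisections_def by blast
  then show ?thesis by blast
qed

end

theory Submission
  imports Defs "HOL-Real_Asymp.Real_Asymp"
begin

text \<open>Replacing \<open>x e\<close> by \<open>1 - x e\<close> on the pairs that cross the bisection turns a feasible point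
  into a semimetric \<open>z\<close> and the cut vector into \<open>0\<close>. Since the coordinates of all feasible points
  have the same sum, subtracting half of this sum from the objective shows that the objective gap of \<open>x\<close>
  is half of the sum of \<open>z\<close> over good pairs minus its sum over bad pairs, where a pair is bad if it
  is a non-edge within a part or an edge across. If every node is in fewer than \<open>n / 4\<close> bad pairs,
  this gap is positive: average \<open>z {i, j} \<le> z {i, k} + z {j, k}\<close> for bad \<open>{i, j}\<close> over the more
  than \<open>n / 2\<close> nodes \<open>k\<close> that form good pairs with both \<open>i\<close> and \<open>j\<close>; every good pair then
  occurs in fewer than \<open>n / 2\<close> of these triangles. The expected number of bad pairs at a node is about
  \<open>(1 - p + q) n / 2 < n / 4\<close>, so Hoeffding's inequality and a union bound finish the proof.\<close>


section \<open>Semimetrics: good pairs outweigh bad pairs\<close>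

lemma semimetric_sum_less:
  fixes d :: "'a \<Rightarrow> 'a \<Rightarrow> real" and D :: nat
  assumes fin: "finite V"
    and Nsym: "\<And>i j. N i j \<longleftrightarrow> N j i"
    and nonneg: "\<And>i j. i \<in> V \<Longrightarrow> j \<in> V \<Longrightarrow> i \<noteq> j \<Longrightarrow> 0 \<le> d i j"
    and tri: "\<And>i j k. \<lbrakk>i \<in> V; j \<in> V; k \<in> V; i \<noteq> j; k \<noteq> i; k \<noteq> j\<rbrakk> \<Longrightarrow> d i j \<le> d i k + d j k"
    and deg: "\<And>i. i \<in> V \<Longrightarrow> card {j\<in>V. i \<noteq> j \<and> N i j} \<le> D"
    and D: "4 * D < card V"
    and nz: "i0 \<in> V" "j0 \<in> V" "i0 \<noteq> j0" "d i0 j0 \<noteq> 0"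
  shows "(\<Sum>i\<in>V. \<Sum>j\<in>V. of_bool (i \<noteq> j \<and> N i j) * d i j)
       < (\<Sum>i\<in>V. \<Sum>j\<in>V. of_bool (i \<noteq> j \<and> \<not> N i j) * d i j)" (is "?B < ?G")
proof -
  \<comment> \<open>\<open>T\<close> selects the triangles used in the averaging. Summing over
    \<open>k\<close> first counts them at a fixed bad pair; summing over \<open>j\<close> first
    counts them at a fixed good pair.\<close>
  define T :: "'a \<Rightarrow> 'a \<Rightarrow> 'a \<Rightarrow> real"
    where "T i j k = of_bool (i \<noteq> j \<and> N i j \<and> i \<noteq> k \<and> \<not> N i k \<and> j \<noteq> k \<and> \<not> N j k)" for i j k
  have card_sum: "(\<Sum>k\<in>V. of_bool (Q k) :: real) = card {k\<in>V. Q k}" for Q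
    using fin by (simp add: sum.If_cases of_bool_def Int_def)
  have B0: "0 \<le> of_bool (i \<noteq> j \<and> N i j) * d i j"
    and G0: "0 \<le> of_bool (i \<noteq> j \<and> \<not> N i j) * d i j" if "i \<in> V" "j \<in> V" for i j
    using nonneg[OF that] by (auto simp: of_bool_def)
  have pos: "0 \<le> ?B" "0 \<le> ?G"
    using B0 G0 by (auto intro!: sum_nonneg)
  have lower: "real (card V - 2 * D) * (of_bool (i \<noteq> j \<and> N i j) * d i j) \<le> (\<Sum>k\<in>V. T i j k * d i j)"
    if ij: "i \<in> V" "j \<in> V" for i j
  proof (cases "i \<noteq> j \<and> N i j")
    case True
    let ?C = "{k\<in>V. i \<noteq> k \<and> \<not> N i k \<and> j \<noteq> k \<and> \<not> N j k}"
    let ?N = "\<lambda>i. {j\<in>V. i \<noteq> j \<and> N i j}"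
    \<comment> \<open>The nodes \<open>i\<close> and \<open>j\<close> cost nothing extra: as the
      pair is bad, \<open>i\<close> lies in \<open>?N j\<close> and \<open>j\<close> in
      \<open>?N i\<close>, so the bound is exactly \<open>card V - 2 * D\<close>.\<close>
    have "V \<subseteq> ?C \<union> (?N i \<union> ?N j)"
      using True Nsym by auto
    then have "card V \<le> card (?C \<union> (?N i \<union> ?N j))"
      using fin by (intro card_mono) auto
    also have "\<dots> \<le> card ?C + (card (?N i) + card (?N j))"
      by (meson add_left_mono card_Un_le le_trans)
    finally have "card V - 2 * D \<le> card ?C"
      using deg[OF ij(1)] deg[OF ij(2)] by linarith
    then have "real (card V - 2 * D) * d i j \<le> real (card ?C) * d i j"
      using nonneg[OF ij] True by (intro mult_right_mono) auto
    also have "real (card ?C) = (\<Sum>k\<in>V. T i j k)"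
      using True by (simp add: T_def card_sum)
    finally show ?thesis
      using True by (simp add: sum_distrib_right)
  qed (auto simp: T_def)
  have upper: "(\<Sum>j\<in>V. T i j k * d i k) \<le> real D * (of_bool (i \<noteq> k \<and> \<not> N i k) * d i k)"
    if ik: "i \<in> V" "k \<in> V" for i k
  proof (cases "i \<noteq> k \<and> \<not> N i k")
    case True
    \<comment> \<open>A triangle on the good pair \<open>i\<close>, \<open>k\<close> is determined
      by its third node, which must be a bad neighbour of \<open>i\<close>; there are at most
      \<open>D\<close> of these.\<close>
    have "(\<Sum>j\<in>V. T i j k) \<le> (\<Sum>j\<in>V. of_bool (i \<noteq> j \<and> N i j))"
      by (intro sum_mono) (auto simp: T_def)
    also have "\<dots> \<le> real D"
      using deg[OF ik(1)] by (simp add: card_sum)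
    finally show ?thesis
      using True nonneg[OF ik] by (simp add: mult_right_mono flip: sum_distrib_right)
  qed (auto simp: T_def)
  have Tsym: "T i j k = T j i k" for i j k
    using Nsym by (auto simp: T_def)
  have "real (card V - 2 * D) * ?B \<le> (\<Sum>i\<in>V. \<Sum>j\<in>V. \<Sum>k\<in>V. T i j k * d i j)"
    unfolding sum_distrib_left by (intro sum_mono lower[unfolded sum_distrib_left]) auto
  also have "\<dots> \<le> (\<Sum>i\<in>V. \<Sum>j\<in>V. \<Sum>k\<in>V. T i j k * d i k + T i j k * d j k)"
    using tri by (intro sum_mono) (auto simp: T_def)
  also have "\<dots> = (\<Sum>i\<in>V. \<Sum>j\<in>V. \<Sum>k\<in>V. T i j k * d i k) + (\<Sum>i\<in>V. \<Sum>j\<in>V. \<Sum>k\<in>V. T i j k * d j k)"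
    by (simp add: sum.distrib)
  \<comment> \<open>Exchanging the roles of \<open>i\<close> and \<open>j\<close> turns the second
    sum into the first. Both are therefore at most \<open>real D * ?G\<close>, whence the factor 2
    in \<open>main\<close>.\<close>
  also have "(\<Sum>i\<in>V. \<Sum>j\<in>V. \<Sum>k\<in>V. T i j k * d j k) = (\<Sum>j\<in>V. \<Sum>i\<in>V. \<Sum>k\<in>V. T j i k * d j k)"
    by (subst sum.swap) (simp add: Tsym)
  also have "(\<Sum>i\<in>V. \<Sum>j\<in>V. \<Sum>k\<in>V. T i j k * d i k) = (\<Sum>i\<in>V. \<Sum>k\<in>V. \<Sum>j\<in>V. T i j k * d i k)"
    by (intro sum.cong refl sum.swap)
  also have "\<dots> \<le> (\<Sum>i\<in>V. \<Sum>k\<in>V. real D * (of_bool (i \<noteq> k \<and> \<not> N i k) * d i k))"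
    by (intro sum_mono upper) auto
  also have "\<dots> = real D * ?G"
    by (simp add: sum_distrib_left)
  finally have main: "real (card V - 2 * D) * ?B \<le> 2 * real D * ?G"
    by linarith
  show ?thesis
  \<comment> \<open>For positive \<open>?G\<close>, strictness comes from 2 \<open>D\<close> <
    \<open>card V\<close> - 2 \<open>D\<close>. If \<open>?G\<close> vanishes, so does
    \<open>?B\<close>, and then every distance is 0, contrary to \<open>nz\<close>.\<close>
  proof (cases "?G = 0")
    case True
    with main have "real (card V - 2 * D) * ?B \<le> 0" by simp
    moreover have "real (card V - 2 * D) > 0" using D by simp
    ultimately have "?B = 0" using pos by (simp add: mult_le_0_iff)
    have zero: "f i0 j0 = 0"
      if "(\<Sum>i\<in>V. \<Sum>j\<in>V. f i j) = 0" "\<And>i j. i \<in> V \<Longrightarrow> j \<in> V \<Longrightarrow> 0 \<le> f i j"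
      for f :: "'a \<Rightarrow> 'a \<Rightarrow> real"
    proof -
      have "(\<Sum>j\<in>V. f i0 j) = 0"
        using that fin nz(1) by (subst (asm) sum_nonneg_eq_0_iff) (auto intro!: sum_nonneg)
      then show ?thesis
        using that(2) fin nz(1,2) by (subst (asm) sum_nonneg_eq_0_iff) auto
    qed
    have "of_bool (i0 \<noteq> j0 \<and> N i0 j0) * d i0 j0 = 0"
      using \<open>?B = 0\<close> B0 by (rule zero)
    moreover have "of_bool (i0 \<noteq> j0 \<and> \<not> N i0 j0) * d i0 j0 = 0"
      using True G0 by (rule zero)
    ultimately show ?thesis using nz by (cases "N i0 j0") auto
  next
    case False
    then have "2 * real D * ?G < real (card V - 2 * D) * ?G"
      using D pos(2) by (intro mult_strict_right_mono) linarith+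
    with main have "real (card V - 2 * D) * ?B < real (card V - 2 * D) * ?G" by linarith
    then show ?thesis by (simp add: mult_less_cancel_left)
  qed
qed

section \<open>Node pairs and bisections\<close>

lemma finite_node_pairs: "finite (node_pairs n)"
  by (rule finite_subset[of _ "Pow {1..n}"]) (auto simp: node_pairs_def)

lemma pair_in_node_pairs [simp]:
  "{i, j} \<in> node_pairs n \<longleftrightarrow> i \<in> {1..n} \<and> j \<in> {1..n} \<and> i \<noteq> j"
  by (auto simp: node_pairs_def card_insert_if)

lemma node_pairsE:
  assumes "e \<in> node_pairs n"
  obtains i j where "i \<in> {1..n}" "j \<in> {1..n}" "i \<noteq> j" "e = {i, j}"
  using assms unfolding node_pairs_def by (auto simp: card_2_iff)

text \<open>Links the double sums of the averaging argument to the sums over pairs in the linear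
  program; each pair arises in two orders.\<close>

lemma sum_node_pairs:
  fixes f :: "nat set \<Rightarrow> real"
  shows "(\<Sum>i\<in>{1..n}. \<Sum>j\<in>{1..n}. of_bool (i \<noteq> j) * f {i, j}) = 2 * (\<Sum>e\<in>node_pairs n. f e)"
proof -
  let ?S = "{(i, j). i \<in> {1..n} \<and> j \<in> {1..n} \<and> i \<noteq> j}" and ?g = "\<lambda>(i, j). {i, j}"
  have finS: "finite ?S"
    by (rule finite_subset[of _ "{1..n} \<times> {1..n}"]) auto
  have "(\<Sum>i\<in>{1..n}. \<Sum>j\<in>{1..n}. of_bool (i \<noteq> j) * f {i, j})
      = (\<Sum>(i, j)\<in>{1..n} \<times> {1..n}. of_bool (i \<noteq> j) * f {i, j})"
    by (rule sum.cartesian_product)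
  also have "\<dots> = (\<Sum>x\<in>?S. f (?g x))"
    by (intro sum.mono_neutral_cong_right) auto
  also have "\<dots> = (\<Sum>e\<in>node_pairs n. \<Sum>x\<in>{x\<in>?S. ?g x = e}. f (?g x))"
    by (intro sum.group[symmetric] finS finite_node_pairs) auto
  also have "\<dots> = (\<Sum>e\<in>node_pairs n. 2 * f e)"
  proof (intro sum.cong refl)
    fix e assume "e \<in> node_pairs n"
    then obtain i j where ij: "i \<in> {1..n}" "j \<in> {1..n}" "i \<noteq> j" "e = {i, j}"
      by (rule node_pairsE)
    then have "{x\<in>?S. ?g x = e} = {(i, j), (j, i)}"
      by (auto simp: doubleton_eq_iff)
    then show "(\<Sum>x\<in>{x\<in>?S. ?g x = e}. f (?g x)) = 2 * f e"
      using ij by (simp add: insert_commute)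
  qed
  finally show ?thesis by (simp add: sum_distrib_left)
qed

text \<open>One side \<open>A\<close> encodes the whole bisection. Being in the same part becomes
  agreement of two truth values, so case analysis on triangles is propositional.\<close>

lemma same_part_bisection:
  assumes "P \<in> bisections (2 * m)"
  shows "\<exists>A\<subseteq>{1..2 * m}. card A = m \<and>
    (\<forall>i\<in>{1..2 * m}. \<forall>j\<in>{1..2 * m}. same_part P {i, j} \<longleftrightarrow> (i \<in> A \<longleftrightarrow> j \<in> A))"
proof -
  from assms obtain A B where P: "P = {A, B}" "A \<noteq> B"
    unfolding bisections_def card_2_iff by auto
  from assms P have *: "A \<union> B = {1..2 * m}" "A \<inter> B = {}" "card A = m"
    unfolding bisections_def partition_on_def disjoint_def by auto
  have "same_part P {i, j} \<longleftrightarrow> (i \<in> A \<longleftrightarrow> j \<in> A)"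
    if "i \<in> {1..2 * m}" "j \<in> {1..2 * m}" for i j
    using that * unfolding same_part_def P(1) by auto
  with * show ?thesis by blast
qed

lemma card_opposite_part:
  assumes "P \<in> bisections (2 * m)" "i \<in> {1..2 * m}"
  shows "card {j\<in>{1..2 * m}. \<not> same_part P {i, j}} = m"
proof -
  obtain A where A: "A \<subseteq> {1..2 * m}" "card A = m"
    "\<And>i j. \<lbrakk>i \<in> {1..2 * m}; j \<in> {1..2 * m}\<rbrakk> \<Longrightarrow> same_part P {i, j} \<longleftrightarrow> (i \<in> A \<longleftrightarrow> j \<in> A)"
    using same_part_bisection[OF assms(1)] by blast
  have "{j\<in>{1..2 * m}. \<not> same_part P {i, j}} = (if i \<in> A then {1..2 * m} - A else A)"
    using A assms(2) by auto
  then show ?thesis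
    using A by (auto simp: card_Diff_subset finite_subset[OF A(1)])
qed

lemma same_part_singleton:
  assumes "P \<in> bisections (2 * m)" "i \<in> {1..2 * m}"
  shows "same_part P {i}"
  using same_part_bisection[OF assms(1)] assms(2) by (metis insert_absorb2)

section \<open>Triangle constraints and switching\<close>

lemma lp_feasible_tri:
  assumes "x \<in> lp_feasible n" "i \<in> {1..n}" "j \<in> {1..n}" "k \<in> {1..n}" "i \<noteq> j" "k \<noteq> i" "k \<noteq> j"
  shows "x {i, j} \<le> x {i, k} + x {j, k}"
proof -
  have *: "x {a, b} \<le> x {a, c} + x {b, c}"
    if "a \<in> {1..n}" "b \<in> {1..n}" "c \<in> {1..n}" "a < b" "c \<noteq> a" "c \<noteq> b" for a b c
    using assms(1) that unfolding lp_feasible_def by blast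
  show ?thesis
    using *[of i j k] *[of j i k] assms(2-7)
    by (cases "i < j") (simp_all add: insert_commute)
qed

lemma lp_feasible_perimeter:
  assumes "x \<in> lp_feasible n" "i \<in> {1..n}" "j \<in> {1..n}" "k \<in> {1..n}" "i \<noteq> j" "k \<noteq> i" "k \<noteq> j"
  shows "x {i, j} + x {i, k} + x {j, k} \<le> 2"
proof -
  have *: "x {a, b} + x {a, c} + x {b, c} \<le> 2"
    if "a \<in> {1..n}" "b \<in> {1..n}" "c \<in> {1..n}" "a < b" "b < c" for a b c
    using assms(1) that unfolding lp_feasible_def by blast
  have "i < j \<and> j < k \<or> i < k \<and> k < j \<or> j < i \<and> i < k \<or> j < k \<and> k < i \<or> k < i \<and> i < j \<or> k < j \<and> j < i"
    using assms(5-7) by linarith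
  then show ?thesis
    using *[of i j k] *[of i k j] *[of j i k] *[of j k i] *[of k i j] *[of k j i] assms(2-4)
    by (elim disjE) (simp_all add: insert_commute)
qed

text \<open>Switching along the bisection maps the cut vector to \<open>0\<close> and permutes the four
  inequalities of each triangle.\<close>

definition switch :: "nat set set \<Rightarrow> (nat set \<Rightarrow> real) \<Rightarrow> nat set \<Rightarrow> real" where
  "switch P x e = (if same_part P e then x e else 1 - x e)"

lemma switch_tri:
  assumes P: "P \<in> bisections (2 * m)" and x: "x \<in> lp_feasible (2 * m)"
    and ijk: "i \<in> {1..2 * m}" "j \<in> {1..2 * m}" "k \<in> {1..2 * m}" "i \<noteq> j" "k \<noteq> i" "k \<noteq> j"
  shows "switch P x {i, j} \<le> switch P x {i, k} + switch P x {j, k}"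
proof -
  obtain A where A: "A \<subseteq> {1..2 * m}" "card A = m"
    "\<And>i j. \<lbrakk>i \<in> {1..2 * m}; j \<in> {1..2 * m}\<rbrakk> \<Longrightarrow> same_part P {i, j} \<longleftrightarrow> (i \<in> A \<longleftrightarrow> j \<in> A)"
    using same_part_bisection[OF P] by blast
  \<comment> \<open>Either no side of the triangle crosses the bisection, or exactly two do. If
    none, the first inequality is the claim; if \<open>{i, j}\<close> and \<open>{i, k}\<close>
    cross, the second; if \<open>{i, j}\<close> and \<open>{j, k}\<close> cross, the third; if
    \<open>{i, k}\<close> and \<open>{j, k}\<close> cross, the perimeter bound.\<close>
  have "x {i, j} \<le> x {i, k} + x {j, k}"
    "x {i, k} \<le> x {i, j} + x {j, k}" "x {j, k} \<le> x {i, j} + x {i, k}"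
    "x {i, j} + x {i, k} + x {j, k} \<le> 2"
    using lp_feasible_tri[OF x, of i j k] lp_feasible_tri[OF x, of i k j]
      lp_feasible_tri[OF x, of j k i] lp_feasible_perimeter[OF x, of i j k] ijk
    by (auto simp: insert_commute)
  then show ?thesis
    using ijk(1-3) by (auto simp: switch_def A(3))
qed

text \<open>The program has no sign constraints, but adding the switched triangle inequalities for
  the other two sides of a triangle on \<open>i\<close>, \<open>j\<close>, \<open>k\<close> leaves
  twice the claim. The bound on \<open>m\<close> supplies the third node \<open>k\<close>.\<close>

lemma switch_nonneg:
  assumes P: "P \<in> bisections (2 * m)" and x: "x \<in> lp_feasible (2 * m)" and m: "m \<ge> 2"
    and ij: "i \<in> {1..2 * m}" "j \<in> {1..2 * m}" "i \<noteq> j"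
  shows "0 \<le> switch P x {i, j}"
proof -
  have "\<not> {1..2 * m} \<subseteq> {i, j}"
    using card_mono[of "{i, j}" "{1..2 * m}"] m ij by auto
  then obtain k where k: "k \<in> {1..2 * m}" "k \<noteq> i" "k \<noteq> j" by blast
  show ?thesis
    using switch_tri[OF P x, of i k j] switch_tri[OF P x, of j k i] ij k
    by (simp add: insert_commute)
qed

section \<open>Feasibility of the cut vector\<close>

lemma cut_vector_pair:
  assumes "i \<in> {1..n}" "j \<in> {1..n}" "i \<noteq> j"
  shows "cut_vector n P {i, j} = of_bool (\<not> same_part P {i, j})"
  using assms by (simp add: cut_vector_def)

lemma sum_cut_vector:
  assumes P: "P \<in> bisections (2 * m)"
  shows "(\<Sum>e\<in>node_pairs (2 * m). cut_vector (2 * m) P e) = real m ^ 2"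
proof -
  have "2 * (\<Sum>e\<in>node_pairs (2 * m). cut_vector (2 * m) P e)
      = (\<Sum>i\<in>{1..2 * m}. \<Sum>j\<in>{1..2 * m}. of_bool (i \<noteq> j) * cut_vector (2 * m) P {i, j})"
    by (rule sum_node_pairs[symmetric])
  \<comment> \<open>The diagonal can be included because a singleton lies within a part and
    contributes 0. Each row then counts the \<open>m\<close> nodes of the opposite part.\<close>
  also have "\<dots> = (\<Sum>i\<in>{1..2 * m}. \<Sum>j\<in>{1..2 * m}. of_bool (\<not> same_part P {i, j}))"
  proof (intro sum.cong refl)
    fix i j assume ij: "i \<in> {1..2 * m}" "j \<in> {1..2 * m}"
    show "of_bool (i \<noteq> j) * cut_vector (2 * m) P {i, j} = of_bool (\<not> same_part P {i, j})"
      using cut_vector_pair[OF ij] same_part_singleton[OF P ij(1)] by (cases "i = j") auto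
  qed
  also have "\<dots> = (\<Sum>i\<in>{1..2 * m}. real m)"
  proof (intro sum.cong refl)
    fix i assume i: "i \<in> {1..2 * m}"
    have "(\<Sum>j\<in>{1..2 * m}. of_bool (\<not> same_part P {i, j}))
        = real (card {j\<in>{1..2 * m}. \<not> same_part P {i, j}})"
      by (simp add: sum.If_cases of_bool_def Int_def)
    then show "(\<Sum>j\<in>{1..2 * m}. of_bool (\<not> same_part P {i, j})) = real m"
      unfolding card_opposite_part[OF P i] .
  qed
  finally show ?thesis by (simp add: power2_eq_square)
qed

lemma cut_vector_feasible:
  assumes P: "P \<in> bisections (2 * m)"
  shows "cut_vector (2 * m) P \<in> lp_feasible (2 * m)"
proof -
  obtain A where A: "A \<subseteq> {1..2 * m}" "card A = m"
    "\<And>i j. \<lbrakk>i \<in> {1..2 * m}; j \<in> {1..2 * m}\<rbrakk> \<Longrightarrow> same_part P {i, j} \<longleftrightarrow> (i \<in> A \<longleftrightarrow> j \<in> A)"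
    using same_part_bisection[OF P] by blast
  have "cut_vector (2 * m) P \<in> extensional (node_pairs (2 * m))"
    by (simp add: cut_vector_def)
  moreover have "(\<Sum>e\<in>node_pairs (2 * m). cut_vector (2 * m) P e) = real (2 * m) ^ 2 / 4"
    unfolding sum_cut_vector[OF P] by simp
  ultimately show ?thesis
    unfolding lp_feasible_def by (auto simp: cut_vector_pair A(3) of_bool_def)
qed

section \<open>Bad pairs and the objective gap\<close>

definition bad_pairs :: "nat \<Rightarrow> nat set set \<Rightarrow> nat set set \<Rightarrow> nat \<Rightarrow> nat set set" where
  "bad_pairs n P E i = {e \<in> node_pairs n. i \<in> e \<and> (e \<in> E \<longleftrightarrow> \<not> same_part P e)}"

lemma card_bad_pairs:
  assumes "i \<in> {1..n}"
  shows "card {j\<in>{1..n}. i \<noteq> j \<and> ({i, j} \<in> E \<longleftrightarrow> \<not> same_part P {i, j})} = card (bad_pairs n P E i)"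
proof (rule bij_betw_same_card[of "\<lambda>j. {i, j}"], unfold bij_betw_def, intro conjI)
  show "(\<lambda>j. {i, j}) ` {j\<in>{1..n}. i \<noteq> j \<and> ({i, j} \<in> E \<longleftrightarrow> \<not> same_part P {i, j})} = bad_pairs n P E i"
    using assms by (auto simp: bad_pairs_def image_iff insert_commute elim!: node_pairsE)
qed (auto simp: inj_on_def doubleton_eq_iff)

lemma objective_less:
  assumes P: "P \<in> bisections (2 * m)" and m: "m \<ge> 2"
    and bad: "\<And>i. i \<in> {1..2 * m} \<Longrightarrow> 2 * card (bad_pairs (2 * m) P E i) < m"
    and y: "y \<in> lp_feasible (2 * m)" "y \<noteq> cut_vector (2 * m) P"
  shows "lp_objective (2 * m) E (cut_vector (2 * m) P) < lp_objective (2 * m) E y"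
proof -
  let ?V = "{1..2 * m}" and ?z = "switch P y" and ?c = "cut_vector (2 * m) P" and ?NP = "node_pairs (2 * m)"
  define N where "N e \<longleftrightarrow> (e \<in> E \<longleftrightarrow> \<not> same_part P e)" for e
  have "\<exists>e\<in>?NP. y e \<noteq> ?c e"
  proof (rule ccontr)
    assume "\<not> ?thesis"
    then have "y = ?c"
      using y(1) by (intro extensionalityI[of _ ?NP]) (auto simp: lp_feasible_def cut_vector_def)
    with y(2) show False by simp
  qed
  then obtain e where e: "e \<in> ?NP" "y e \<noteq> ?c e" ..
  then obtain i0 j0 where ij0: "i0 \<in> ?V" "j0 \<in> ?V" "i0 \<noteq> j0" "e = {i0, j0}"
    by (elim node_pairsE)
  moreover have "?z e \<noteq> 0"
    using e by (simp add: switch_def cut_vector_def split: if_splits)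
  ultimately have nz: "i0 \<in> ?V" "j0 \<in> ?V" "i0 \<noteq> j0" "?z {i0, j0} \<noteq> 0"
    by simp_all
  have "(\<Sum>i\<in>?V. \<Sum>j\<in>?V. of_bool (i \<noteq> j \<and> N {i, j}) * ?z {i, j})
      < (\<Sum>i\<in>?V. \<Sum>j\<in>?V. of_bool (i \<noteq> j \<and> \<not> N {i, j}) * ?z {i, j})"
  \<comment> \<open>\<open>(m - 1) div 2\<close> is the largest degree \<open>D\<close> with 2
    \<open>D\<close> < \<open>m\<close>, which is exactly what \<open>bad\<close> allows; it
    satisfies 4 \<open>D\<close> < 2 \<open>m\<close>, the number of nodes.\<close>
  proof (rule semimetric_sum_less[where D = "(m - 1) div 2" and ?i0.0 = i0 and ?j0.0 = j0])
    show "card {j\<in>?V. i \<noteq> j \<and> N {i, j}} \<le> (m - 1) div 2" if "i \<in> ?V" for i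
      using bad[OF that] card_bad_pairs[OF that, of E P] by (simp add: N_def)
    show "?z {i, j} \<le> ?z {i, k} + ?z {j, k}"
      if "i \<in> ?V" "j \<in> ?V" "k \<in> ?V" "i \<noteq> j" "k \<noteq> i" "k \<noteq> j" for i j k
      using switch_tri[OF P y(1) that] .
    show "0 \<le> ?z {i, j}" if "i \<in> ?V" "j \<in> ?V" "i \<noteq> j" for i j
      using switch_nonneg[OF P y(1) m that] .
    show "4 * ((m - 1) div 2) < card ?V"
      using m by simp
    show "i0 \<in> ?V" "j0 \<in> ?V" "i0 \<noteq> j0" "?z {i0, j0} \<noteq> 0"
      using nz .
  qed (simp_all add: insert_commute)
  moreover have "(\<Sum>i\<in>?V. \<Sum>j\<in>?V. of_bool (i \<noteq> j \<and> \<not> N {i, j}) * ?z {i, j})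
      - (\<Sum>i\<in>?V. \<Sum>j\<in>?V. of_bool (i \<noteq> j \<and> N {i, j}) * ?z {i, j})
      = (\<Sum>i\<in>?V. \<Sum>j\<in>?V. of_bool (i \<noteq> j) * ((if N {i, j} then -1 else 1) * ?z {i, j}))"
    unfolding sum_subtractf[symmetric] by (intro sum.cong refl) auto
  ultimately have "0 < (\<Sum>i\<in>?V. \<Sum>j\<in>?V. of_bool (i \<noteq> j) * ((if N {i, j} then -1 else 1) * ?z {i, j}))"
    by linarith
  then have pos: "0 < (\<Sum>e\<in>?NP. (if N e then -1 else 1) * ?z e)"
    unfolding sum_node_pairs[where f = "\<lambda>e. (if N e then -1 else 1) * ?z e"] by simp
  \<comment> \<open>The equal coordinate sums allow the 0/1 edge weights to be replaced, after
    doubling, by weights 1 on edges and -1 on non-edges.\<close>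
  have "(\<Sum>e\<in>?NP. y e - ?c e) = 0"
    using y(1) cut_vector_feasible[OF P] by (simp add: lp_feasible_def sum_subtractf)
  then have "2 * (lp_objective (2 * m) E y - lp_objective (2 * m) E ?c)
     = 2 * (lp_objective (2 * m) E y - lp_objective (2 * m) E ?c) - (\<Sum>e\<in>?NP. y e - ?c e)"
    by simp
  also have "\<dots> = (\<Sum>e\<in>?NP. 2 * (of_bool (e \<in> E) * y e - of_bool (e \<in> E) * ?c e) - (y e - ?c e))"
    unfolding lp_objective_def of_bool_def
    by (simp only: sum_subtractf sum_distrib_left right_diff_distrib)
  \<comment> \<open>The difference \<open>y e - ?c e\<close> is \<open>?z e\<close> within a part
    and \<open>- ?z e\<close> across. Multiplied by the edge weight 1 or -1, this gives a minus sign
    exactly on bad pairs.\<close>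
  also have "\<dots> = (\<Sum>e\<in>?NP. (if N e then -1 else 1) * ?z e)"
    by (intro sum.cong) (auto simp: N_def switch_def cut_vector_def)
  finally have eq: "2 * (lp_objective (2 * m) E y - lp_objective (2 * m) E ?c)
      = (\<Sum>e\<in>?NP. (if N e then -1 else 1) * ?z e)" .
  show ?thesis
    using pos unfolding eq[symmetric] by simp
qed

lemma lp_recovers_if_few_bad_pairs:
  assumes P: "P \<in> bisections (2 * m)" and m: "m \<ge> 2"
    and bad: "\<And>i. i \<in> {1..2 * m} \<Longrightarrow> 2 * card (bad_pairs (2 * m) P E i) < m"
  shows "lp_recovers (2 * m) P E"
proof -
  have "lp_objective (2 * m) E (cut_vector (2 * m) P) < lp_objective (2 * m) E y"
    if "y \<in> lp_feasible (2 * m)" "y \<noteq> cut_vector (2 * m) P" for y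
    using objective_less[OF assms that] .
  then show ?thesis
    using cut_vector_feasible[OF P]
    unfolding lp_recovers_def lp_optimal_def by (metis linorder_not_less order.order_iff_strict)
qed

section \<open>Concentration of the number of bad pairs\<close>

text \<open>The bijection behind \<open>card_bad_pairs\<close> is reused at two extreme edge sets:
  for \<open>UNIV\<close> the bad pairs are those across, for \<open>{}\<close> those within a part.
  The latter number \<open>m - 1\<close> since a node is not paired with itself.\<close>

lemma card_same_part_pairs:
  assumes P: "P \<in> bisections (2 * m)" and i: "i \<in> {1..2 * m}"
  shows "card {e \<in> node_pairs (2 * m). i \<in> e \<and> same_part P e} = m - 1"
    and "card {e \<in> node_pairs (2 * m). i \<in> e \<and> \<not> same_part P e} = m"
proof -
  let ?V = "{1..2 * m}"
  have cross: "{j\<in>?V. i \<noteq> j \<and> \<not> same_part P {i, j}} = {j\<in>?V. \<not> same_part P {i, j}}"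
    using same_part_singleton[OF P i] by auto
  then show cross': "card {e \<in> node_pairs (2 * m). i \<in> e \<and> \<not> same_part P e} = m"
    using card_bad_pairs[OF i, of UNIV P] card_opposite_part[OF P i] by (simp add: bad_pairs_def)
  have "{j\<in>?V. i \<noteq> j \<and> same_part P {i, j}} = (?V - {i}) - {j\<in>?V. \<not> same_part P {i, j}}"
    by auto
  moreover have "{j\<in>?V. \<not> same_part P {i, j}} \<subseteq> ?V - {i}"
    using same_part_singleton[OF P i] by auto
  ultimately have "card {j\<in>?V. i \<noteq> j \<and> same_part P {i, j}} = (2 * m - 1) - m"
    using i card_opposite_part[OF P i] by (simp add: card_Diff_subset)
  then show "card {e \<in> node_pairs (2 * m). i \<in> e \<and> same_part P e} = m - 1"
    using card_bad_pairs[OF i, of "{}" P] by (simp add: bad_pairs_def)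
qed

text \<open>The law of the edges in \<open>sbm\<close> given the planted bisection; the estimates
  are made conditionally on \<open>P\<close>.\<close>

definition edge_indicators :: "nat \<Rightarrow> real \<Rightarrow> real \<Rightarrow> nat set set \<Rightarrow> (nat set \<Rightarrow> bool) pmf" where
  "edge_indicators n p q P =
     Pi_pmf (node_pairs n) False (\<lambda>e. bernoulli_pmf (if same_part P e then p else q))"

text \<open>The count is a sum of 2 \<open>m\<close> - 1 independent indicators with mean at most
  \<open>m\<close> / 2 - \<open>m\<close> \<open>\<delta>\<close>, where \<open>\<delta>\<close> =
  \<open>p - q - 1 / 2\<close>. Reaching \<open>m\<close> / 2 is thus an upward deviation of at
  least \<open>m\<close> \<open>\<delta>\<close>, to which Hoeffding's inequality applies.\<close>

lemma prob_many_bad_pairs_le: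
  fixes p q :: real
  assumes pq: "0 < q" "p < 1" "p - q > 1 / 2"
    and P: "P \<in> bisections (2 * m)" and i: "i \<in> {1..2 * m}"
  shows "measure_pmf.prob (edge_indicators (2 * m) p q P)
      {f. m \<le> 2 * card (bad_pairs (2 * m) P {e \<in> node_pairs (2 * m). f e} i)}
    \<le> exp (- ((p - q - 1 / 2)\<^sup>2 * m))"
proof -
  let ?M = "edge_indicators (2 * m) p q P" and ?NP = "node_pairs (2 * m)"
  define \<delta> where "\<delta> = p - q - 1 / 2"
  define S where "S = {e \<in> ?NP. i \<in> e}"
  define X :: "nat set \<Rightarrow> (nat set \<Rightarrow> bool) \<Rightarrow> real"
    where "X e f = of_bool (f e \<longleftrightarrow> \<not> same_part P e)" for e f
  have m: "m \<ge> 1" using i by simp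
  have finS: "finite S" by (simp add: S_def finite_node_pairs)
  have S_split: "S = {e \<in> ?NP. i \<in> e \<and> same_part P e} \<union> {e \<in> ?NP. i \<in> e \<and> \<not> same_part P e}"
    by (auto simp: S_def)
  have cardS: "card S = 2 * m - 1"
    unfolding S_split using m card_same_part_pairs[OF P i]
    by (subst card_Un_disjoint) (auto simp: finite_node_pairs)
  have EX: "measure_pmf.expectation ?M (X e) = (if same_part P e then 1 - p else q)" if "e \<in> S" for e
  proof -
    have "measure_pmf.expectation ?M (X e)
        = measure_pmf.expectation (map_pmf (\<lambda>f. f e) ?M) (\<lambda>b. of_bool (b \<longleftrightarrow> \<not> same_part P e))"
      by (simp add: X_def[abs_def])
    also have "map_pmf (\<lambda>f. f e) ?M = bernoulli_pmf (if same_part P e then p else q)"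
      unfolding edge_indicators_def using that
      by (subst Pi_pmf_component) (auto simp: S_def finite_node_pairs)
    finally show ?thesis using pq by simp
  qed
  interpret Hoeffding_ineq "measure_pmf ?M" S X "\<lambda>_. 0" "\<lambda>_. 1"
    "\<Sum>e\<in>S. measure_pmf.expectation ?M (X e)"
  proof unfold_locales
    \<comment> \<open>Independence passes from the coordinates of the product to \<open>X\<close>,
      since each \<open>X e\<close> depends on the coordinate \<open>e\<close> alone.\<close>
    have "prob_space.indep_vars (measure_pmf ?M) (\<lambda>_. count_space UNIV) (\<lambda>e f. f e) S"
      unfolding edge_indicators_def
      by (rule prob_space.indep_vars_subset[OF measure_pmf.prob_space_axioms
            indep_vars_Pi_pmf[OF finite_node_pairs]]) (auto simp: S_def)
    then show "prob_space.indep_vars (measure_pmf ?M) (\<lambda>_. borel) X S"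
      unfolding X_def by (rule prob_space.indep_vars_compose2[OF measure_pmf.prob_space_axioms]) auto
  qed (auto simp: finS X_def)
  have "(\<Sum>e\<in>S. measure_pmf.expectation ?M (X e)) = (\<Sum>e\<in>S. if same_part P e then 1 - p else q)"
    by (intro sum.cong) (auto simp: EX)
  also have "\<dots> = (real m - 1) * (1 - p) + real m * q"
    unfolding S_split using m card_same_part_pairs[OF P i]
    by (subst sum.union_disjoint) (auto simp: finite_node_pairs of_nat_diff)
  \<comment> \<open>Rounding \<open>m - 1\<close> up to \<open>m\<close> bounds the mean by
    \<open>m\<close> times 1 - \<open>p\<close> + \<open>q\<close>, and this factor is 1/2 -
    \<open>\<delta>\<close>.\<close>
  also have "\<dots> \<le> m / 2 - m * \<delta>"
    using pq by (simp add: \<delta>_def algebra_simps)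
  finally have mean: "(\<Sum>e\<in>S. measure_pmf.expectation ?M (X e)) + m * \<delta> \<le> m / 2"
    by simp
  have count: "real (card (bad_pairs (2 * m) P {e \<in> ?NP. f e} i)) = (\<Sum>e\<in>S. X e f)" for f
  proof -
    have "(\<Sum>e\<in>S. X e f) = real (card {e\<in>S. f e \<longleftrightarrow> \<not> same_part P e})"
      using finS by (simp add: X_def sum.If_cases of_bool_def Int_def)
    also have "{e\<in>S. f e \<longleftrightarrow> \<not> same_part P e} = bad_pairs (2 * m) P {e \<in> ?NP. f e} i"
      by (auto simp: bad_pairs_def S_def)
    finally show ?thesis ..
  qed
  have "measure_pmf.prob ?M {f. m \<le> 2 * card (bad_pairs (2 * m) P {e \<in> ?NP. f e} i)}
      \<le> measure_pmf.prob ?M {f \<in> space (measure_pmf ?M).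
           (\<Sum>e\<in>S. measure_pmf.expectation ?M (X e)) + m * \<delta> \<le> (\<Sum>e\<in>S. X e f)}"
  proof (intro measure_pmf.finite_measure_mono subsetI CollectI conjI)
    fix f assume "f \<in> {f. m \<le> 2 * card (bad_pairs (2 * m) P {e \<in> ?NP. f e} i)}"
    then have "real m \<le> 2 * real (card (bad_pairs (2 * m) P {e \<in> ?NP. f e} i))"
      unfolding mem_Collect_eq by linarith
    with mean show "(\<Sum>e\<in>S. measure_pmf.expectation ?M (X e)) + m * \<delta> \<le> (\<Sum>e\<in>S. X e f)"
      unfolding count by linarith
  qed auto
  also have "\<dots> \<le> exp (- 2 * (m * \<delta>)\<^sup>2 / (\<Sum>e\<in>S. (1 - 0)\<^sup>2))"
    using pq m cardS by (intro Hoeffding_ineq_ge) (auto simp: \<delta>_def)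
  \<comment> \<open>The 2 \<open>m\<close> - 1 summands all have range 1, so the denominator is
    below 2 \<open>m\<close> and the exponent is at most
    \<open>- (\<delta>\<^sup>2 * m)\<close>.\<close>
  also have "\<dots> \<le> exp (- (\<delta>\<^sup>2 * m))"
    using m pq by (simp add: \<delta>_def cardS of_nat_diff divide_simps power_mult_distrib)
      (simp add: algebra_simps power2_eq_square)
  finally show ?thesis by (simp add: \<delta>_def)
qed

lemma prob_not_recovers_le:
  fixes p q :: real
  assumes pq: "0 < q" "p < 1" "p - q > 1 / 2"
    and P: "P \<in> bisections (2 * m)" and m: "m \<ge> 2"
  shows "measure_pmf.prob (edge_indicators (2 * m) p q P)
      {f. \<not> lp_recovers (2 * m) P {e \<in> node_pairs (2 * m). f e}}
    \<le> 2 * m * exp (- ((p - q - 1 / 2)\<^sup>2 * m))" (is "measure_pmf.prob ?M ?F \<le> _")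
proof -
  let ?B = "\<lambda>i. {f. m \<le> 2 * card (bad_pairs (2 * m) P {e \<in> node_pairs (2 * m). f e} i)}"
  have "?F \<subseteq> (\<Union>i\<in>{1..2 * m}. ?B i)"
    using lp_recovers_if_few_bad_pairs[OF P m] by (force simp: not_le)
  then have "measure_pmf.prob ?M ?F \<le> measure_pmf.prob ?M (\<Union>i\<in>{1..2 * m}. ?B i)"
    by (intro measure_pmf.finite_measure_mono) auto
  also have "\<dots> \<le> (\<Sum>i\<in>{1..2 * m}. measure_pmf.prob ?M (?B i))"
    by (intro measure_pmf.finite_measure_subadditive_finite) auto
  also have "\<dots> \<le> (\<Sum>i\<in>{1..2 * m}. exp (- ((p - q - 1 / 2)\<^sup>2 * m)))"
    by (intro sum_mono prob_many_bad_pairs_le pq P)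
  finally show ?thesis by simp
qed

section \<open>From a fixed bisection to the random one, and the limit\<close>

text \<open>The probability under a mixture is the average of the conditional ones, so a failure
  bound uniform in the planted bisection carries over to \<open>sbm\<close>.\<close>

lemma prob_bind_pmf_le:
  assumes "\<And>x. x \<in> set_pmf M \<Longrightarrow> measure_pmf.prob (N x) A \<le> c" and "0 \<le> c"
  shows "measure_pmf.prob (bind_pmf M N) A \<le> c"
proof -
  have "emeasure (measure_pmf (bind_pmf M N)) A = (\<integral>\<^sup>+x. emeasure (measure_pmf (N x)) A \<partial>measure_pmf M)"
    by simp
  also have "\<dots> \<le> (\<integral>\<^sup>+x. ennreal c \<partial>measure_pmf M)"
    using assms(1)
    by (intro nn_integral_mono_AE) (auto simp: AE_measure_pmf_iff measure_pmf.emeasure_eq_measure ennreal_leI)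
  also have "\<dots> = ennreal c"
    by simp
  finally show ?thesis
    using assms(2) by (simp add: measure_pmf.emeasure_eq_measure del: emeasure_bind_pmf)
qed

theorem theorem6:
  fixes p q :: real
  assumes "0 < q" and "q < p" and "p < 1" and "p - q > 1 / 2"
  shows "(\<lambda>m. measure_pmf.prob (sbm (2 * m) p q) {(P, E). lp_recovers (2 * m) P E}) \<longlonglongrightarrow> 1"
proof (rule tendsto_sandwich[where h = "\<lambda>_. 1"])
  define \<delta> where "\<delta> = p - q - 1 / 2"
  have "\<delta> > 0" using assms by (simp add: \<delta>_def)
  \<comment> \<open>Exponential decay beats the linear factor 2 \<open>m\<close> from the union
    bound over nodes.\<close>
  then show "(\<lambda>m. 1 - 2 * real m * exp (- (\<delta>\<^sup>2 * m))) \<longlonglongrightarrow> 1"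
    by real_asymp
  show "\<forall>\<^sub>F m in sequentially. 1 - 2 * real m * exp (- (\<delta>\<^sup>2 * m))
      \<le> measure_pmf.prob (sbm (2 * m) p q) {(P, E). lp_recovers (2 * m) P E}"
    \<comment> \<open>From \<open>m\<close> = 2 on, bisections exist and every pair of nodes has a
      third node to form a triangle with.\<close>
    using eventually_ge_at_top[of 2]
  proof eventually_elim
    case (elim m)
    let ?R = "{(P, E). lp_recovers (2 * m) P E}"
    have "measure_pmf.prob (sbm (2 * m) p q) (- ?R) \<le> 2 * real m * exp (- (\<delta>\<^sup>2 * m))"
      unfolding sbm_def
    proof (rule prob_bind_pmf_le)
      fix P assume "P \<in> set_pmf (pmf_of_set (bisections (2 * m)))"
      then have "P \<in> bisections (2 * m)"
        using elim by (simp add: finite_bisections bisections_nonempty)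
      from prob_not_recovers_le[OF assms(1,3,4) this elim]
      show "measure_pmf.prob (map_pmf (\<lambda>f. (P, {e \<in> node_pairs (2 * m). f e}))
          (Pi_pmf (node_pairs (2 * m)) False (\<lambda>e. bernoulli_pmf (if same_part P e then p else q)))) (- ?R)
        \<le> 2 * real m * exp (- (\<delta>\<^sup>2 * m))"
        by (simp add: edge_indicators_def \<delta>_def vimage_def)
    qed simp
    then show ?case
      using measure_pmf.prob_compl[of ?R "sbm (2 * m) p q"] by (simp add: Compl_eq_Diff_UNIV)
  qed
qed (auto intro!: always_eventually)

end
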